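(* Let $\lambda$ be a nonzero real number. For every positive integer $r$ and every integer $n\ge0$, $$ \sum_{k=0}^{n}\binom{x+k}{k}(k)_{r,\lambda}=\sum_{j=0}^{r}\binom{x+j}{j}\binom{x+n+1}{n-j}j!{r \brace j}_{\lambda} =\sum_{j=0}^{r}\binom{x+j}{j}\binom{x+n+1}{n-j}\sum_{k=0}^{j}\binom{j}{k}(-1)^{j-k}(k)_{r,\lambda}. $$
   Context: For a real parameter $\mu$ the degenerate falling factorials are $(x)_{0,\mu}=1$ and $(x)_{n,\mu}=x(x-\mu)\cdots(x-(n-1)\mu)$ for $n\ge1$; $(x)_n=(x)_{n,1}$ is the usual falling factorial. Binomial coefficients are $\binom{y}{m}=(y)_m/m!$ for integers $m\ge0$ and $\binom{y}{m}=0$ for integers $m<0$. The degenerate Stirling numbers of the second kind ${n \brace k}_{\mu}$ are defined by $(x)_{n,\mu}=\sum_{k=0}^{n}{n \brace k}_{\mu}(x)_k$. *)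

theory Defs
  imports Complex_Main
begin

definition dfall :: "real \<Rightarrow> real \<Rightarrow> nat \<Rightarrow> real" where
  "dfall \<mu> x n = (\<Prod>i<n. x - real i * \<mu>)"

text \<open>The library's \<^term>\<open>y gchoose m\<close> takes a natural lower index only; this is its extension by
  zero to negative integers.\<close>

definition gbinom_int :: "real \<Rightarrow> int \<Rightarrow> real" where
  "gbinom_int y m = (if m < 0 then 0 else y gchoose nat m)"

text \<open>The coefficients of \<^term>\<open>dfall \<mu> x n\<close> in the basis of ordinary falling factorials. The
  defining identity fixes only the entries with \<open>k \<le> n\<close>; the others are set to zero so that the
  description is unique.\<close>

definition dstirling :: "real \<Rightarrow> nat \<Rightarrow> nat \<Rightarrow> real" where
  "dstirling \<mu> n =
     (THE c. (\<forall>x. dfall \<mu> x n = (\<Sum>k=0..n. c k * dfall 1 x k)) \<and> (\<forall>k>n. c k = 0))"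

lemma gchoose_eq_dfall: "(y::real) gchoose m = dfall 1 y m / fact m"
  by (simp add: gbinomial_prod_rev dfall_def atLeast0LessThan)

lemma dfall_Suc: "dfall \<mu> x (Suc n) = dfall \<mu> x n * (x - real n * \<mu>)"
  by (simp add: dfall_def)

lemma dfall_1_zero: "m < k \<Longrightarrow> dfall 1 (real m) k = 0"
  by (auto simp: dfall_def)

lemma dfall_1_self_nonzero: "dfall 1 (real m) m \<noteq> 0"
  by (auto simp: dfall_def)

lemma dstirling_exists:
  "\<exists>c. (\<forall>x. dfall \<mu> x n = (\<Sum>k=0..n. c k * dfall 1 x k)) \<and> (\<forall>k>n. c k = 0)"
proof (induction n)
  case 0
  show ?case
    by (rule exI[of _ "\<lambda>k. if k = 0 then 1 else 0"]) (simp add: dfall_def)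
next
  case (Suc n)
  then obtain c where c: "\<And>x. dfall \<mu> x n = (\<Sum>k=0..n. c k * dfall 1 x k)"
    and c0: "\<And>k. k > n \<Longrightarrow> c k = 0" by blast
  define d where "d k = (if k = 0 then 0 else c (k - 1)) + (real k - real n * \<mu>) * c k" for k
  have "dfall \<mu> x (Suc n) = (\<Sum>k=0..Suc n. d k * dfall 1 x k)" for x
  proof -
    have "dfall \<mu> x (Suc n) = (\<Sum>k=0..n. c k * dfall 1 x k * (x - real n * \<mu>))"
      by (simp add: dfall_Suc c sum_distrib_right)
    also have "\<dots> = (\<Sum>k=0..n. c k * dfall 1 x (Suc k))
        + (\<Sum>k=0..n. (real k - real n * \<mu>) * c k * dfall 1 x k)"
      unfolding sum.distrib[symmetric] by (rule sum.cong) (simp_all add: dfall_Suc algebra_simps)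
    also have "(\<Sum>k=0..n. c k * dfall 1 x (Suc k))
        = (\<Sum>k=0..Suc n. (if k = 0 then 0 else c (k - 1)) * dfall 1 x k)"
      by (subst sum.atLeast0_atMost_Suc_shift) simp
    also have "(\<Sum>k=0..n. (real k - real n * \<mu>) * c k * dfall 1 x k)
        = (\<Sum>k=0..Suc n. (real k - real n * \<mu>) * c k * dfall 1 x k)"
      by (simp add: c0)
    finally show ?thesis
      unfolding sum.distrib[symmetric] d_def by (simp only: distrib_right)
  qed
  moreover have "d k = 0" if "k > Suc n" for k
    using that c0[of k] c0[of "k - 1"] by (simp add: d_def)
  ultimately show ?case by blast
qed

lemma dfall_1_coeffs_unique:
  assumes "\<And>x. (\<Sum>k=0..n. c k * dfall 1 x k) = (\<Sum>k=0..n. d k * dfall 1 x k)" and "m \<le> n"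
  shows "c m = d m"
  using assms(2)
proof (induction m rule: less_induct)
  case (less m)
  have split: "(\<Sum>k=0..n. f k * dfall 1 (real m) k)
      = (\<Sum>k<m. f k * dfall 1 (real m) k) + f m * dfall 1 (real m) m" for f
  proof -
    have "(\<Sum>k=0..n. f k * dfall 1 (real m) k) = (\<Sum>k<Suc m. f k * dfall 1 (real m) k)"
      by (rule sum.mono_neutral_right) (use less.prems in \<open>auto simp: dfall_1_zero\<close>)
    then show ?thesis by simp
  qed
  have "(\<Sum>k<m. c k * dfall 1 (real m) k) = (\<Sum>k<m. d k * dfall 1 (real m) k)"
    using less by (intro sum.cong) auto
  then have "c m * dfall 1 (real m) m = d m * dfall 1 (real m) m"
    using assms(1)[of "real m"] by (simp add: split)
  then show ?case using dfall_1_self_nonzero by simp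
qed

lemma dstirling_ex1:
  "\<exists>!c. (\<forall>x. dfall \<mu> x n = (\<Sum>k=0..n. c k * dfall 1 x k)) \<and> (\<forall>k>n. c k = 0)"
proof (rule ex_ex1I[OF dstirling_exists])
  fix c d :: "nat \<Rightarrow> real"
  assume c: "(\<forall>x. dfall \<mu> x n = (\<Sum>k=0..n. c k * dfall 1 x k)) \<and> (\<forall>k>n. c k = 0)"
    and d: "(\<forall>x. dfall \<mu> x n = (\<Sum>k=0..n. d k * dfall 1 x k)) \<and> (\<forall>k>n. d k = 0)"
  have "c m = d m" for m
  proof (cases "m \<le> n")
    case True
    have "(\<Sum>k=0..n. c k * dfall 1 x k) = (\<Sum>k=0..n. d k * dfall 1 x k)" for x
      using c d by metis
    from dfall_1_coeffs_unique[OF this True] show ?thesis .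
  next
    case False
    then show ?thesis using c d by simp
  qed
  then show "c = d" by blast
qed

lemma dfall_eq_sum_dstirling: "dfall \<mu> x n = (\<Sum>k=0..n. dstirling \<mu> n k * dfall 1 x k)"
  and dstirling_eq_0: "k > n \<Longrightarrow> dstirling \<mu> n k = 0"
  using theI'[OF dstirling_ex1[of \<mu> n], folded dstirling_def] by blast+

end

theory Submission
  imports Defs
begin

text \<open>Expanding \<open>(k)\<^bsub>r,\<lambda>\<^esub>\<close> in falling factorials \<open>(k)\<^sub>j\<close> reduces the first equality to the
  sums of \<open>(x + k gchoose k) (k)\<^sub>j\<close> over \<open>k\<close>. Trinomial revision turns each summand into
  \<open>(x + 1)\<cdots>(x + j)\<close> times \<open>x + k gchoose (k - j)\<close>, and the parallel summation formula applies.
  The second equality is binomial inversion of the same expansion at the points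
  \<open>k = 0, \<dots>, j\<close>.\<close>

lemma dfall_1_of_nat: "dfall 1 (real k) j = fact j * real (k choose j)"
  using gchoose_eq_dfall[of "real k" j] by (simp add: binomial_gbinomial)

text \<open>Since \<open>(x + real k) gchoose k\<close> is (x+1)...(x+k)/k! and (k)_j = k!/(k-j)!,
  the k! cancels. Splitting the rising product after j factors leaves (x+j+1)...(x+k)/(k-j)!, the
  last binomial.\<close>

lemma gbinomial_times_dfall_1:
  fixes x :: real
  assumes "j \<le> k"
  shows "((x + real k) gchoose k) * dfall 1 (real k) j
       = fact j * ((x + real j) gchoose j) * ((x + real k) gchoose (k - j))"
proof -
  have "pochhammer (x + 1) k = pochhammer (x + 1) j * pochhammer (x + 1 + real j) (k - j)"
    using assms by (rule pochhammer_product)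
  moreover have "real (k choose j) = fact k / (fact j * fact (k - j))"
    using assms by (rule binomial_fact)
  ultimately show ?thesis
    using assms by (simp add: gbinomial_pochhammer' dfall_1_of_nat of_nat_diff algebra_simps)
qed

lemma sum_gbinomial_times_dfall_1:
  fixes x :: real
  shows "(\<Sum>k=0..n. ((x + real k) gchoose k) * dfall 1 (real k) j)
       = fact j * ((x + real j) gchoose j) * gbinom_int (x + real n + 1) (int n - int j)"
proof (cases "j \<le> n")
  case False
  \<comment> \<open>Both sides vanish: (k)_j = 0 for k \<le> n < j, and the lower index n - j is
    negative.\<close>
  then show ?thesis
    by (simp add: dfall_1_zero gbinom_int_def)
next
  case True
  have "(\<Sum>k=0..n. ((x + real k) gchoose k) * dfall 1 (real k) j)
      = (\<Sum>k=j..n. ((x + real k) gchoose k) * dfall 1 (real k) j)"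
    by (rule sum.mono_neutral_right) (auto simp: dfall_1_zero)
  also have "\<dots> = fact j * ((x + real j) gchoose j) * (\<Sum>k=j..n. (x + real k) gchoose (k - j))"
    by (simp add: gbinomial_times_dfall_1 sum_distrib_left)
  \<comment> \<open>Shifting by j gives parallel summation its form with base x + j; its upper
    argument (x + j) + (n - j) + 1 is x + n + 1.\<close>
  also have "(\<Sum>k=j..n. (x + real k) gchoose (k - j))
      = (\<Sum>k\<le>n - j. (x + real j + real k) gchoose k)"
    by (rule sum.reindex_bij_witness[of _ "\<lambda>k. k + j" "\<lambda>k. k - j"])
      (use True in \<open>auto simp: of_nat_diff\<close>)
  also have "\<dots> = (x + real n + 1) gchoose (n - j)"
    using True gbinomial_parallel_sum[of "x + real j" "n - j"] by (simp add: of_nat_diff)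
  finally show ?thesis
    using True by (simp add: gbinom_int_def nat_diff_distrib')
qed

text \<open>Orthogonality behind binomial inversion: trinomial revision pulls out
  \<open>j choose i\<close> and leaves an alternating row sum.\<close>

lemma sum_alternating_choose_choose:
  "(\<Sum>k=0..j. real (j choose k) * (-1) ^ (j - k) * real (k choose i)) = (if i = j then 1 else 0)"
proof (cases "i \<le> j")
  case False
  then show ?thesis
    by (intro trans[OF sum.neutral]) auto
next
  case True
  have "(\<Sum>k=0..j. real (j choose k) * (-1) ^ (j - k) * real (k choose i))
      = (\<Sum>k=i..j. real (j choose k) * (-1) ^ (j - k) * real (k choose i))"
    by (rule sum.mono_neutral_right) auto
  also have "\<dots> = (\<Sum>k=i..j. real (j choose i) * (real (j - i choose (k - i)) * (-1) ^ (j - k)))"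
  proof (rule sum.cong)
    fix k assume "k \<in> {i..j}"
    then have "real (j choose k) * real (k choose i) = real (j choose i) * real (j - i choose (k - i))"
      using choose_mult[of i k j] by (simp flip: of_nat_mult)
    then show "real (j choose k) * (-1) ^ (j - k) * real (k choose i)
        = real (j choose i) * (real (j - i choose (k - i)) * (-1) ^ (j - k))"
      by (simp add: mult_ac)
  qed simp
  also have "\<dots> = real (j choose i) * (\<Sum>k\<le>j - i. real (j - i choose k) * (-1) ^ (j - i - k))"
    unfolding sum_distrib_left
    by (rule sum.reindex_bij_witness[of _ "\<lambda>k. k + i" "\<lambda>k. k - i"]) (use True in auto)
  \<comment> \<open>The row sum is a power of 0, equal to 1 exactly when i = j.\<close>
  also have "(\<Sum>k\<le>j - i. real (j - i choose k) * (-1) ^ (j - i - k)) = (1 + - 1) ^ (j - i)"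
    by (subst binomial_ring) simp
  finally show ?thesis
    using True by auto
qed

text \<open>At integers k the expansion has terms i! \<open>dstirling \<mu> r i\<close>
  \<open>(k choose i)\<close>, so orthogonality isolates i = j, an index in range as j \<le>
  r.\<close>

lemma fact_times_dstirling:
  assumes "j \<le> r"
  shows "fact j * dstirling \<mu> r j
       = (\<Sum>k=0..j. real (j choose k) * (-1) ^ (j - k) * dfall \<mu> (real k) r)"
proof -
  have "(\<Sum>k=0..j. real (j choose k) * (-1) ^ (j - k) * dfall \<mu> (real k) r)
      = (\<Sum>k=0..j. \<Sum>i=0..r. fact i * dstirling \<mu> r i
           * (real (j choose k) * (-1) ^ (j - k) * real (k choose i)))"
    by (simp add: dfall_eq_sum_dstirling[of \<mu>] dfall_1_of_nat sum_distrib_left mult_ac)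
  also have "\<dots> = (\<Sum>i=0..r. fact i * dstirling \<mu> r i
           * (\<Sum>k=0..j. real (j choose k) * (-1) ^ (j - k) * real (k choose i)))"
    unfolding sum_distrib_left by (rule sum.swap)
  also have "\<dots> = fact j * dstirling \<mu> r j"
    using assms by (simp add: sum_alternating_choose_choose if_distrib cong: if_cong)
  finally show ?thesis ..
qed

theorem theorem2p10:
  fixes lam x :: real and r n :: nat
  assumes "lam \<noteq> 0" and "r \<ge> 1"
  shows "(\<Sum>k=0..n. ((x + real k) gchoose k) * dfall lam (real k) r)
         = (\<Sum>j=0..r. ((x + real j) gchoose j) * gbinom_int (x + real n + 1) (int n - int j)
              * fact j * dstirling lam r j)
       \<and> (\<Sum>j=0..r. ((x + real j) gchoose j) * gbinom_int (x + real n + 1) (int n - int j)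
              * fact j * dstirling lam r j)
         = (\<Sum>j=0..r. ((x + real j) gchoose j) * gbinom_int (x + real n + 1) (int n - int j)
              * (\<Sum>k=0..j. real (j choose k) * (-1) ^ (j - k) * dfall lam (real k) r))"
proof
  have "(\<Sum>k=0..n. ((x + real k) gchoose k) * dfall lam (real k) r)
      = (\<Sum>k=0..n. \<Sum>j=0..r. dstirling lam r j
           * (((x + real k) gchoose k) * dfall 1 (real k) j))"
    by (simp add: dfall_eq_sum_dstirling[of lam] sum_distrib_left mult_ac)
  \<comment> \<open>After the interchange the inner sum over k is free of \<open>lam\<close> and has
    a closed form.\<close>
  also have "\<dots> = (\<Sum>j=0..r. dstirling lam r j
           * (\<Sum>k=0..n. ((x + real k) gchoose k) * dfall 1 (real k) j))"
    unfolding sum_distrib_left by (rule sum.swap)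
  also have "\<dots> = (\<Sum>j=0..r. ((x + real j) gchoose j)
           * gbinom_int (x + real n + 1) (int n - int j) * fact j * dstirling lam r j)"
    unfolding sum_gbinomial_times_dfall_1 by (simp add: mult_ac)
  finally show "(\<Sum>k=0..n. ((x + real k) gchoose k) * dfall lam (real k) r)
      = (\<Sum>j=0..r. ((x + real j) gchoose j) * gbinom_int (x + real n + 1) (int n - int j)
           * fact j * dstirling lam r j)" .
next
  show "(\<Sum>j=0..r. ((x + real j) gchoose j) * gbinom_int (x + real n + 1) (int n - int j)
           * fact j * dstirling lam r j)
      = (\<Sum>j=0..r. ((x + real j) gchoose j) * gbinom_int (x + real n + 1) (int n - int j)
           * (\<Sum>k=0..j. real (j choose k) * (-1) ^ (j - k) * dfall lam (real k) r))"
    by (rule sum.cong) (simp_all flip: fact_times_dstirling)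
qed

end
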